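(* Let $N\ge1$ be an integer, and let $U$ be the operator $$Uf(x)=\sum_{i\ge N}V_{N,i}(x)\,f\left(\frac{N}{x+i}\right),\qquad V_{N,i}(x)=\frac{x+N}{(x+i)(x+i+1)},\quad x\in I=[0,1].$$ (i) Let $f\in L^\infty(I)$. (a) If $f$ is non-decreasing (respectively non-increasing), then $Uf$ is non-increasing (respectively non-decreasing). (b) If $f$ is monotone, then $\operatorname{var}(Uf)\le\dfrac{1}{N+1}\operatorname{var}f$. (ii) For any $f\in L(I)$, $s(Uf)\le q\cdot s(f)$, where $$q:=N\left(\sum_{i\ge N}\left(\frac{N}{i^3(i+1)}+\frac{i+1-N}{i(i+1)^3}\right)\right).$$
   Context: $L^\infty(I)$ denotes the collection of all bounded measurable functions $f:I\to\mathbb{C}$ (not equivalence classes; monotone means real-valued and monotone). The variation is $\operatorname{var}f:=\sup\sum_{i=1}^{k-1}|f(t_{i+1})-f(t_i)|$, the supremum being over $t_1<\cdots<t_k$ in $I$, $k\ge2$. $L(I)$ is the space of all complex-valued Lipschitz continuous functions on $I$, and $s(f):=\sup_{x\ne y}\frac{|f(x)-f(y)|}{|x-y|}$. *)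

theory Defs
  imports "HOL-Analysis.Analysis"
begin

text \<open>Functions on the interval I = [0,1] are represented by total functions on the reals of which
  only the values on I matter: for i \<ge> N \<ge> 1 and x in I the point N/(x+i) lies in I.\<close>

abbreviation unit_ivl :: "real set"
  where "unit_ivl \<equiv> {0..1}"

definition Linfty_space :: "real set \<Rightarrow> (real \<Rightarrow> complex) set"
  where "Linfty_space I =
    {f. f \<in> borel_measurable (restrict_space borel I) \<and> bounded (f ` I)}"

definition Lipschitz_space :: "real set \<Rightarrow> (real \<Rightarrow> complex) set"
  where "Lipschitz_space I = {f. \<exists>C. C-lipschitz_on I f}"

definition nondecreasing_on :: "real set \<Rightarrow> (real \<Rightarrow> complex) \<Rightarrow> bool"
  where "nondecreasing_on I f \<longleftrightarrow> f ` I \<subseteq> \<real> \<and> mono_on I (\<lambda>x. Re (f x))"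

definition nonincreasing_on :: "real set \<Rightarrow> (real \<Rightarrow> complex) \<Rightarrow> bool"
  where "nonincreasing_on I f \<longleftrightarrow> f ` I \<subseteq> \<real> \<and> antimono_on I (\<lambda>x. Re (f x))"

text \<open>The suprema below are taken in the extended reals, so that they are meaningful without any
  finiteness assumption.\<close>

definition variation_on :: "real set \<Rightarrow> (real \<Rightarrow> complex) \<Rightarrow> ereal"
  where "variation_on I f =
    (SUP (k, t) \<in> {(k :: nat, t :: nat \<Rightarrow> real).
        k \<ge> 2 \<and> strict_mono_on {1..k} t \<and> t ` {1..k} \<subseteq> I}.
      ereal (\<Sum>i=1..k-1. norm (f (t (i + 1)) - f (t i))))"

definition lip_seminorm_on :: "real set \<Rightarrow> (real \<Rightarrow> complex) \<Rightarrow> ereal"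
  where "lip_seminorm_on I f =
    (SUP (x, y) \<in> {(x, y). x \<in> I \<and> y \<in> I \<and> x \<noteq> y}.
      ereal (norm (f x - f y) / \<bar>x - y\<bar>))"

definition V_coeff :: "nat \<Rightarrow> nat \<Rightarrow> real \<Rightarrow> real"
  where "V_coeff N i x = (x + real N) / ((x + real i) * (x + real i + 1))"

definition U_op :: "nat \<Rightarrow> (real \<Rightarrow> complex) \<Rightarrow> real \<Rightarrow> complex"
  where "U_op N f x =
    (\<Sum>\<^sub>\<infinity>i\<in>{N..}. complex_of_real (V_coeff N i x) * f (real N / (x + real i)))"

definition q_const :: "nat \<Rightarrow> real"
  where "q_const N = real N *
    (\<Sum>\<^sub>\<infinity>i\<in>{N..}. (real N / (real i ^ 3 * (real i + 1))
        + (real i + 1 - real N) / (real i * (real i + 1) ^ 3)))"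

end

(* The tail sums V_{N,N+n}(x) + V_{N,N+n+1}(x) + ... equal (x+N)/(x+N+n), non-decreasing in x.
   So for x <= y the probability weights V_{N,i}(y) sit at larger i than V_{N,i}(x), while
   N/(x+i) decreases in i and in x; this makes U reverse monotonicity.
   The variation of the monotone function Uf is |Uf(0) - Uf(1)|, which telescopes after an index
   shift, as both weight families become multiples of 1/(i(i+1)).
   For Lipschitz f, split Uf(y) - Uf(x) into the change of the evaluation points and the change
   of the weights. Summation by parts bounds the second part by s(f)|y-x| times the second sum
   in q. The first part is at most s(f)|y-x| times the V_{N,i}(y)-average of N/i^2, and by
   stochastic dominance this average is largest at y = 0, where it is the first sum in q. *)

theory Submission
  imports Defs
begin

section \<open>Abel summation and the symmetry under negation of \<open>f\<close>\<close>

text \<open>Moves the differences from \<open>D\<close> to \<open>a\<close>. The vector-valued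
  \<open>a\<close> serves both the real sequences of the dominance argument and the complex values
  of \<open>f\<close> in the Lipschitz estimate.\<close>

lemma sum_by_parts:
  fixes D :: "nat \<Rightarrow> real" and a :: "nat \<Rightarrow> 'a::real_vector"
  shows "(\<Sum>n<m. (D n - D (Suc n)) *\<^sub>R a n)
    = D 0 *\<^sub>R a 0 - D m *\<^sub>R a m + (\<Sum>n<m. D (Suc n) *\<^sub>R (a (Suc n) - a n))"
  by (induction m) (auto simp: algebra_simps)

text \<open>Together with the three sign rules that follow, this reduces non-increasing
  \<open>f\<close> to the non-decreasing \<open>- f\<close>.\<close>

lemma U_op_uminus: "U_op N (\<lambda>t. - f t) = (\<lambda>x. - U_op N f x)"
  by (simp add: fun_eq_iff U_op_def infsum_uminus)

lemma nondecreasing_on_uminus_iff: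
  "nondecreasing_on I (\<lambda>t. - f t) \<longleftrightarrow> nonincreasing_on I f"
  by (auto simp: nondecreasing_on_def nonincreasing_on_def monotone_on_def image_subset_iff)

lemma nonincreasing_on_uminus_iff:
  "nonincreasing_on I (\<lambda>t. - f t) \<longleftrightarrow> nondecreasing_on I f"
  by (auto simp: nondecreasing_on_def nonincreasing_on_def monotone_on_def image_subset_iff)

lemma variation_on_uminus: "variation_on I (\<lambda>t. - f t) = variation_on I f"
  by (simp add: variation_on_def norm_minus_commute)

section \<open>Variation and endpoint values\<close>

text \<open>All increments along a chain have the same sign, so their norms telescope to
  \<open>g (t 1) - g (t k)\<close>, which the endpoints of the interval dominate.\<close>

lemma variation_on_nonincreasing_le:
  assumes g: "nonincreasing_on unit_ivl g"
  shows "variation_on unit_ivl g \<le> ereal (Re (g 0) - Re (g 1))"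
  unfolding variation_on_def
proof (rule SUP_least, clarify)
  fix k :: nat and t :: "nat \<Rightarrow> real"
  assume k: "2 \<le> k" and t: "strict_mono_on {1..k} t" and tI: "t ` {1..k} \<subseteq> unit_ivl"
  have anti: "antimono_on unit_ivl (\<lambda>x. Re (g x))" and re: "g ` unit_ivl \<subseteq> \<real>"
    using g by (auto simp: nonincreasing_on_def)
  have tin: "t i \<in> unit_ivl" if "1 \<le> i" "i \<le> k" for i
    using tI that by (meson atLeastAtMost_iff image_subset_iff)
  have "(\<Sum>i=1..k-1. norm (g (t (i + 1)) - g (t i)))
      = (\<Sum>i=1..k-1. Re (g (t i)) - Re (g (t (Suc i))))"
  proof (rule sum.cong[OF refl])
    fix i assume i: "i \<in> {1..k-1}"
    then have ii: "1 \<le> i" "i + 1 \<le> k" using k by auto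
    have "t i \<le> t (i + 1)"
      using t ii by (auto simp: strict_mono_on_def intro: less_imp_le)
    then have "Re (g (t (i + 1))) \<le> Re (g (t i))"
      using ii by (intro monotone_onD[OF anti] tin) auto
    moreover have "g (t (i + 1)) - g (t i) \<in> \<real>"
      using re tin[of i] tin[of "i + 1"] ii by (intro Reals_diff) auto
    ultimately show "norm (g (t (i + 1)) - g (t i)) = Re (g (t i)) - Re (g (t (Suc i)))"
      by (simp add: in_Reals_norm)
  qed
  also have "\<dots> = Re (g (t 1)) - Re (g (t k))"
  proof -
    have "(\<Sum>i=1..j. Re (g (t i)) - Re (g (t (Suc i)))) = Re (g (t 1)) - Re (g (t (Suc j)))" for j
      by (induction j) auto
    from this[of "k - 1"] k show ?thesis by simp
  qed
  also have "\<dots> \<le> Re (g 0) - Re (g 1)"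
    using tin[of 1] tin[of k] k by (intro diff_mono monotone_onD[OF anti]) auto
  finally show "ereal (\<Sum>i=1..k-1. norm (g (t (i + 1)) - g (t i))) \<le> ereal (Re (g 0) - Re (g 1))"
    by simp
qed

lemma variation_on_ge: "ereal (norm (f 1 - f 0)) \<le> variation_on unit_ivl f"
  unfolding variation_on_def
  \<comment> \<open>The two-point chain 0, 1; chain indices start at 1, hence the shift.\<close>
  by (rule SUP_upper2[where i = "(2, \<lambda>i. real i - 1)"])
    (auto simp: strict_mono_on_def numeral_2_eq_2)

section \<open>The weights and their tails\<close>

text \<open>For \<open>x \<ge> 0\<close>, the closed form of the sum of
  \<open>V_coeff N (N + j) x\<close> over \<open>j \<ge> n\<close>; the index \<open>n\<close>
  counts from the first weight \<open>N\<close>.\<close>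

definition V_tail :: "nat \<Rightarrow> nat \<Rightarrow> real \<Rightarrow> real"
  where "V_tail N n x = (x + real N) / (x + real (N + n))"

context
  fixes N :: nat
  assumes N: "N \<ge> 1"
begin

lemma V_coeff_nonneg: "x \<ge> 0 \<Longrightarrow> V_coeff N i x \<ge> 0"
  by (simp add: V_coeff_def)

text \<open>Partial fractions: 1/((x+i)(x+i+1)) = 1/(x+i) - 1/(x+i+1).\<close>

lemma V_coeff_eq_V_tail_diff:
  assumes "x \<ge> 0"
  shows "V_coeff N (N + n) x = V_tail N n x - V_tail N (Suc n) x"
proof -
  have "x + real (N + n) > 0" using N assms by simp
  then show ?thesis
    by (simp add: V_coeff_def V_tail_def divide_simps) (simp add: algebra_simps)
qed

lemma V_tail_0: "x \<ge> 0 \<Longrightarrow> V_tail N 0 x = 1"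
  using N by (simp add: V_tail_def)

lemma V_tail_tendsto_0: "(\<lambda>n. V_tail N n x) \<longlonglongrightarrow> 0"
proof -
  have "filterlim (\<lambda>n. x + real (N + n)) at_top sequentially"
    unfolding of_nat_add
    by (intro filterlim_tendsto_add_at_top[OF tendsto_const] filterlim_real_sequentially)
  then show ?thesis
    unfolding V_tail_def
    by (intro real_tendsto_divide_at_top[OF tendsto_const])
qed

text \<open>The exact form gives more than the sign: with \<open>i = N + n\<close>, its instance at
  \<open>Suc n\<close> is the source of the factor (i+1-N)/(i+1)^2 in the second sum of q.\<close>

lemma V_tail_diff:
  assumes "x \<ge> 0" "y \<ge> 0"
  shows "V_tail N n y - V_tail N n x
    = (y - x) * real n / ((x + real (N + n)) * (y + real (N + n)))"
proof -
  have "x + real (N + n) > 0" "y + real (N + n) > 0" using N assms by simp_all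
  then show ?thesis
    by (simp add: V_tail_def divide_simps) (simp add: algebra_simps)
qed

lemma V_tail_mono:
  assumes "0 \<le> x" "x \<le> y"
  shows "V_tail N n x \<le> V_tail N n y"
proof -
  have "V_tail N n y - V_tail N n x \<ge> 0"
    using assms by (subst V_tail_diff) auto
  then show ?thesis by simp
qed

lemma V_coeff_sums_1:
  assumes "x \<ge> 0"
  shows "(\<lambda>n. V_coeff N (N + n) x) sums 1"
  using telescope_sums'[OF V_tail_tendsto_0, of x]
  by (simp add: V_coeff_eq_V_tail_diff V_tail_0 assms)

text \<open>Comparison with \<open>B\<close> times the weights, which sum to 1. The general algebra
  covers real and complex sequences alike.\<close>

lemma V_coeff_mult_summable:
  fixes a :: "nat \<Rightarrow> 'a::real_normed_algebra_1"
  assumes "x \<ge> 0" "\<And>n. norm (a n) \<le> B"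
  shows "summable (\<lambda>n. norm (of_real (V_coeff N (N + n) x) * a n))"
proof (rule summable_comparison_test')
  show "summable (\<lambda>n. V_coeff N (N + n) x * B)"
    using V_coeff_sums_1[OF assms(1)] by (intro summable_mult2) (rule sums_summable)
  show "norm (norm (of_real (V_coeff N (N + n) x) * a n)) \<le> V_coeff N (N + n) x * B" for n
    using norm_mult_ineq[of "of_real (V_coeff N (N + n) x)" "a n"]
      mult_left_mono[OF assms(2)[of n] V_coeff_nonneg[OF assms(1), of "N + n"]]
      V_coeff_nonneg[OF assms(1), of "N + n"]
    by simp
qed

text \<open>Stochastic dominance: going from \<open>x\<close> to \<open>y\<close> shifts weight to
  larger indices, where a decreasing sequence is smaller.\<close>

lemma V_coeff_sums_decseq_le:
  assumes "0 \<le> x" "x \<le> y" and a: "decseq a" "\<And>n. \<bar>a n\<bar> \<le> B"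
    and x: "(\<lambda>n. V_coeff N (N + n) x * a n) sums s"
    and y: "(\<lambda>n. V_coeff N (N + n) y * a n) sums t"
  shows "t \<le> s"
proof -
  define D where "D n = V_tail N n y - V_tail N n x" for n
  have D: "D n \<ge> 0" "D 0 = 0" for n
    using V_tail_mono[OF assms(1,2)] assms(1,2) by (auto simp: D_def V_tail_0)
  have V_diff: "V_coeff N (N + n) y - V_coeff N (N + n) x = D n - D (Suc n)" for n
    using assms(1,2) by (simp add: D_def V_coeff_eq_V_tail_diff del: of_nat_add)
  have lim: "(\<lambda>m. D m * B) \<longlonglongrightarrow> 0"
    unfolding D_def by (auto intro!: tendsto_eq_intros V_tail_tendsto_0)
  have "(\<lambda>m. \<Sum>n<m. V_coeff N (N + n) y * a n - V_coeff N (N + n) x * a n) \<longlonglongrightarrow> t - s"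
    using sums_diff[OF y x] by (simp add: sums_def)
  \<comment> \<open>After summation by parts, every term is a non-negative tail difference times a
    non-positive increment of \<open>a\<close>; only the boundary term at \<open>m\<close> remains,
    and it vanishes in the limit.\<close>
  moreover have "(\<Sum>n<m. V_coeff N (N + n) y * a n - V_coeff N (N + n) x * a n) \<le> D m * B" for m
  proof -
    have "(\<Sum>n<m. V_coeff N (N + n) y * a n - V_coeff N (N + n) x * a n)
        = (\<Sum>n<m. (D n - D (Suc n)) *\<^sub>R a n)"
      by (simp add: V_diff[symmetric] left_diff_distrib)
    also have "\<dots> = - (D m * a m) + (\<Sum>n<m. D (Suc n) * (a (Suc n) - a n))"
      using sum_by_parts[of D a m] D(2) by simp
    also have "\<dots> \<le> D m * B + 0"
    proof (rule add_mono)
      show "- (D m * a m) \<le> D m * B"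
        using mult_left_mono[of "- a m" B "D m"] a(2)[of m] D(1)[of m] by simp
      show "(\<Sum>n<m. D (Suc n) * (a (Suc n) - a n)) \<le> 0"
        using a(1) D(1) by (intro sum_nonpos mult_nonneg_nonpos) (auto simp: decseq_Suc_iff)
    qed
    finally show ?thesis by simp
  qed
  ultimately have "t - s \<le> 0"
    using lim by (intro LIMSEQ_le) auto
  then show ?thesis by simp
qed

section \<open>Convergence of the series defining \<open>U_op\<close>\<close>

lemma U_op_point_mem: "x \<ge> 0 \<Longrightarrow> real N / (x + real (N + n)) \<in> unit_ivl"
  using N by simp

text \<open>Absolute convergence lets the unordered sum over \<open>{N..}\<close> be read as an
  ordinary series in \<open>n = i - N\<close>.\<close>

lemma U_op_sums:
  assumes "\<And>t. t \<in> unit_ivl \<Longrightarrow> norm (f t) \<le> B" "x \<ge> 0"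
  shows "(\<lambda>n. of_real (V_coeff N (N + n) x) * f (real N / (x + real (N + n)))) sums U_op N f x"
proof -
  let ?g = "\<lambda>i. of_real (V_coeff N i x) * f (real N / (x + real i))"
  have "summable (\<lambda>n. norm (?g (N + n)))"
    using assms U_op_point_mem by (intro V_coeff_mult_summable[where B = B]) auto
  then have s: "summable (\<lambda>n. ?g (N + n))" and
    h: "((\<lambda>n. ?g (N + n)) has_sum (\<Sum>n. ?g (N + n))) UNIV"
    by (auto intro: summable_norm_cancel norm_summable_imp_has_sum summable_sums)
  have "(?g has_sum (\<Sum>n. ?g (N + n))) (plus N ` UNIV)"
    using h by (subst has_sum_reindex) (auto simp: o_def)
  moreover have "plus N ` UNIV = {N..}"
    by (auto simp: image_iff le_iff_add)
  ultimately have "U_op N f x = (\<Sum>n. ?g (N + n))"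
    unfolding U_op_def by (simp add: infsumI)
  with s show ?thesis by (simp add: summable_sums)
qed

section \<open>Reversal of monotonicity and the variation bound\<close>

lemma U_op_antimono:
  assumes b: "\<And>t. t \<in> unit_ivl \<Longrightarrow> norm (f t) \<le> B" and f: "nondecreasing_on unit_ivl f"
  shows "nonincreasing_on unit_ivl (U_op N f)"
  unfolding nonincreasing_on_def
proof
  show "U_op N f ` unit_ivl \<subseteq> \<real>"
  proof safe
    fix x :: real assume x: "x \<in> unit_ivl"
    have "f (real N / (x + real (N + n))) \<in> \<real>" for n
      using U_op_point_mem[of x n] f x by (auto simp: nondecreasing_on_def)
    then have "Im (f (real N / (x + real (N + n)))) = 0" for n
      by (simp only: complex_is_Real_iff)
    then have "(\<lambda>n. 0) sums Im (U_op N f x)"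
      using sums_Im[OF U_op_sums[of f B x, OF b]] x by simp
    then show "U_op N f x \<in> \<real>"
      by (simp add: complex_is_Real_iff sums_0 sums_unique2[of "\<lambda>_. 0"])
  qed
  have mono: "mono_on unit_ivl (\<lambda>t. Re (f t))" using f by (simp add: nondecreasing_on_def)
  show "antimono_on unit_ivl (\<lambda>x. Re (U_op N f x))"
  proof (rule monotone_onI)
    fix x y :: real assume xy: "x \<in> unit_ivl" "y \<in> unit_ivl" "x \<le> y"
    let ?r = "\<lambda>z n. Re (f (real N / (z + real (N + n))))"
    have s: "(\<lambda>n. V_coeff N (N + n) z * ?r z n) sums Re (U_op N f z)" if "z \<ge> 0" for z
      using sums_Re[OF U_op_sums[of f B z, OF b]] that by simp
    have rb: "\<bar>?r z n\<bar> \<le> B" if "z \<ge> 0" for z n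
      using b[OF U_op_point_mem[OF that, of n]] abs_Re_le_cmod order_trans by blast
    have "summable (\<lambda>n. V_coeff N (N + n) y * ?r x n)"
      using summable_norm_cancel[OF V_coeff_mult_summable[of y "?r x" B]] rb xy by auto
    \<comment> \<open>The intermediate value \<open>t\<close> has the weights of \<open>y\<close>
      but the evaluation points of \<open>x\<close>: one comparison moves only the points, the other
      only the weights.\<close>
    then obtain t where t: "(\<lambda>n. V_coeff N (N + n) y * ?r x n) sums t"
      by (auto simp: summable_def)
    have "Re (U_op N f y) \<le> t"
    proof (rule sums_le[OF _ s t])
      show "V_coeff N (N + n) y * ?r y n \<le> V_coeff N (N + n) y * ?r x n" for n
        using xy N U_op_point_mem[of x n] U_op_point_mem[of y n]
        by (intro mult_left_mono V_coeff_nonneg mono_onD[OF mono] divide_left_mono) auto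
    qed (use xy in auto)
    also have "t \<le> Re (U_op N f x)"
    proof (rule V_coeff_sums_decseq_le[OF _ _ _ _ s t])
      show "decseq (?r x)"
        unfolding decseq_Suc_iff
      proof
        fix n show "?r x (Suc n) \<le> ?r x n"
          using xy N U_op_point_mem[of x n] U_op_point_mem[of x "Suc n"]
          by (intro mono_onD[OF mono] divide_left_mono) auto
      qed
    qed (use xy rb in auto)
    finally show "Re (U_op N f x) \<ge> Re (U_op N f y)" .
  qed
qed

lemma U_op_diff_le:
  assumes b: "\<And>t. t \<in> unit_ivl \<Longrightarrow> norm (f t) \<le> B" and f: "nondecreasing_on unit_ivl f"
  shows "Re (U_op N f 0) - Re (U_op N f 1) \<le> (Re (f 1) - Re (f 0)) / (real N + 1)"
proof -
  let ?r = "\<lambda>n. Re (f (real N / real (N + n)))"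
  have mono: "mono_on unit_ivl (\<lambda>t. Re (f t))" using f by (simp add: nondecreasing_on_def)
  have "(\<lambda>n. V_coeff N (N + n) 0 * ?r n) sums Re (U_op N f 0)"
    using sums_Re[OF U_op_sums[of f B 0, OF b]] by simp
  \<comment> \<open>Splitting off the term \<open>n = 0\<close>, which is f(1)/(N+1), leaves a
    series over the same evaluation points N/(N+n+1) as the one at \<open>x = 1\<close>.\<close>
  then have "(\<lambda>n. V_coeff N (N + Suc n) 0 * ?r (Suc n)) sums
      (Re (U_op N f 0) - Re (f 1) / (real N + 1))"
    using N by (subst sums_Suc_iff) (simp add: V_coeff_def)
  moreover have "(\<lambda>n. V_coeff N (N + n) 1 * ?r (Suc n)) sums Re (U_op N f 1)"
    using sums_Re[OF U_op_sums[of f B 1, OF b]] by (simp add: add_ac)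
  ultimately have 1: "(\<lambda>n. (V_coeff N (N + n) 1 - V_coeff N (N + Suc n) 0) * ?r (Suc n)) sums
      (Re (U_op N f 1) - (Re (U_op N f 0) - Re (f 1) / (real N + 1)))"
    by (simp add: left_diff_distrib sums_diff)
  \<comment> \<open>Both weights have the denominator (N+n+1)(N+n+2), with numerators N+1 and
    N.\<close>
  have V: "V_coeff N (N + n) 1 - V_coeff N (N + Suc n) 0
      = V_coeff N (N + n) 1 / (real N + 1)" for n
    by (simp add: V_coeff_def divide_simps)
  have 2: "(\<lambda>n. V_coeff N (N + n) 1 / (real N + 1) * Re (f 0)) sums (1 / (real N + 1) * Re (f 0))"
    by (intro sums_mult2 sums_divide V_coeff_sums_1) simp
  \<comment> \<open>The remaining weights have total mass 1/(N+1), and \<open>f 0\<close> is the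
    least value of \<open>f\<close>.\<close>
  have "1 / (real N + 1) * Re (f 0) \<le> Re (U_op N f 1) - (Re (U_op N f 0) - Re (f 1) / (real N + 1))"
  proof (rule sums_le[OF _ 2 1[unfolded V]])
    show "V_coeff N (N + n) 1 / (real N + 1) * Re (f 0)
        \<le> V_coeff N (N + n) 1 / (real N + 1) * ?r (Suc n)" for n
      by (intro mult_left_mono mono_onD[OF mono]) (auto simp: V_coeff_nonneg)
  qed
  then show ?thesis by (simp add: diff_divide_distrib)
qed

lemma variation_on_U_op_le:
  assumes b: "\<And>t. t \<in> unit_ivl \<Longrightarrow> norm (f t) \<le> B" and f: "nondecreasing_on unit_ivl f"
  shows "variation_on unit_ivl (U_op N f) \<le> ereal (1 / (real N + 1)) * variation_on unit_ivl f"
proof -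
  have "variation_on unit_ivl (U_op N f) \<le> ereal (Re (U_op N f 0) - Re (U_op N f 1))"
    by (intro variation_on_nonincreasing_le U_op_antimono[of f B, OF b f]) auto
  also have "\<dots> \<le> ereal (1 / (real N + 1) * norm (f 1 - f 0))"
  proof -
    have "(Re (f 1) - Re (f 0)) / (real N + 1) \<le> norm (f 1 - f 0) / (real N + 1)"
      using complex_Re_le_cmod[of "f 1 - f 0"] by (intro divide_right_mono) auto
    with U_op_diff_le[of f B, OF b f] show ?thesis by simp
  qed
  also have "\<dots> = ereal (1 / (real N + 1)) * ereal (norm (f 1 - f 0))" by simp
  also have "\<dots> \<le> ereal (1 / (real N + 1)) * variation_on unit_ivl f"
    by (intro ereal_mult_left_mono variation_on_ge) auto
  finally show ?thesis .
qed

section \<open>The constant q and the Lipschitz estimate\<close>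

text \<open>Rewrites q in the shape the estimate produces, with \<open>i = N + n\<close>: a weight
  at 0 times N/i^2, plus a tail-difference bound times the gap N/(i(i+1)) between evaluation
  points.\<close>

lemma q_const_sums:
  "(\<lambda>n. V_coeff N (N + n) 0 * (real N / real (N + n) ^ 2)
      + real (Suc n) / real (N + Suc n) ^ 2 * (real N / (real (N + n) * real (N + Suc n))))
    sums q_const N"
proof -
  let ?h = "\<lambda>i. real N / (real i ^ 3 * (real i + 1))
        + (real i + 1 - real N) / (real i * (real i + 1) ^ 3)"
  have "summable (\<lambda>n. norm (?h (N + n)))"
  proof (rule summable_comparison_test')
    \<comment> \<open>Each of the two fractions is at most N/(i(i+1)), the weight at 0; hence the
      factor 2.\<close>
    show "summable (\<lambda>n. V_coeff N (N + n) 0 * 2)"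
      using V_coeff_sums_1[of 0] by (intro summable_mult2) (auto intro: sums_summable)
    fix n
    define i where "i = real (N + n)"
    have i: "i \<ge> 1" "i \<ge> real N" using N by (auto simp: i_def)
    have V: "V_coeff N (N + n) 0 = real N / (i * (i + 1))"
      by (simp add: V_coeff_def i_def)
    have "real N / (i ^ 3 * (i + 1)) \<le> real N / (i * (i + 1))"
      using i by (intro divide_left_mono mult_right_mono) (auto simp: power_increasing[of 1 3 i, simplified])
    moreover have "(i + 1 - real N) / (i * (i + 1) ^ 3) \<le> real N / (i * (i + 1))"
    proof -
      have "(i + 1 - real N) / (i * (i + 1) ^ 3) \<le> (i + 1) ^ 2 / (i * (i + 1) ^ 3)"
        using i self_le_power[of "i + 1" 2] by (intro divide_right_mono) auto
      also have "\<dots> = 1 / (i * (i + 1))"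
        using i by (simp add: divide_simps) (simp add: power2_eq_square power3_eq_cube)
      also have "\<dots> \<le> real N / (i * (i + 1))"
        using i N by (intro divide_right_mono) auto
      finally show ?thesis .
    qed
    moreover have "0 \<le> real N / (i ^ 3 * (i + 1))" "0 \<le> (i + 1 - real N) / (i * (i + 1) ^ 3)"
      using i by auto
    moreover have "\<bar>p + r\<bar> \<le> v * 2" if "p \<le> v" "r \<le> v" "0 \<le> p" "0 \<le> r" for p r v :: real
      using that by simp
    ultimately show "norm (norm (?h (N + n))) \<le> V_coeff N (N + n) 0 * 2"
      unfolding V i_def[symmetric] real_norm_def abs_idempotent by blast
  qed
  then have s: "summable (\<lambda>n. ?h (N + n))" and
    h: "((\<lambda>n. ?h (N + n)) has_sum (\<Sum>n. ?h (N + n))) UNIV"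
    by (auto intro: summable_norm_cancel norm_summable_imp_has_sum summable_sums)
  have "(?h has_sum (\<Sum>n. ?h (N + n))) (plus N ` UNIV)"
    using h by (subst has_sum_reindex) (auto simp: o_def)
  moreover have "plus N ` UNIV = {N..}"
    by (auto simp: image_iff le_iff_add)
  ultimately have "q_const N = real N * (\<Sum>n. ?h (N + n))"
    unfolding q_const_def by (simp add: infsumI)
  with s have "(\<lambda>n. real N * ?h (N + n)) sums q_const N"
    by (simp only: summable_sums sums_mult)
  moreover have "real N * ?h (N + n) = V_coeff N (N + n) 0 * (real N / real (N + n) ^ 2)
      + real (Suc n) / real (N + Suc n) ^ 2 * (real N / (real (N + n) * real (N + Suc n)))" for n
  proof -
    define i where "i = real (N + n)"
    have i: "i > 0" "real (N + Suc n) = i + 1" "real (Suc n) = i + 1 - real N"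
      using N by (auto simp: i_def)
    have "real N * (real N / (i ^ 3 * (i + 1)) + (i + 1 - real N) / (i * (i + 1) ^ 3))
      = real N / (i * (i + 1)) * (real N / i ^ 2)
        + (i + 1 - real N) / (i + 1) ^ 2 * (real N / (i * (i + 1)))"
      by (simp add: distrib_left power2_eq_square power3_eq_cube mult_ac)
    then show ?thesis
      unfolding i(2,3) i_def[symmetric] by (simp add: V_coeff_def i_def)
  qed
  ultimately show ?thesis by simp
qed

lemma U_op_lipschitz:
  assumes f: "\<And>s t. s \<in> unit_ivl \<Longrightarrow> t \<in> unit_ivl \<Longrightarrow> norm (f s - f t) \<le> L * \<bar>s - t\<bar>"
    and L: "L \<ge> 0" and xy: "0 \<le> x" "x < y"
  shows "norm (U_op N f y - U_op N f x) \<le> q_const N * L * (y - x)"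
proof -
  define B where "B = norm (f 0) + L"
  have b: "norm (f t) \<le> B" if "t \<in> unit_ivl" for t
  proof -
    have "norm (f t) \<le> norm (f 0) + norm (f t - f 0)" by (rule norm_triangle_sub)
    also have "norm (f t - f 0) \<le> L * t" using f[of t 0] that by simp
    also have "L * t \<le> L" using that L by (simp add: mult_left_le)
    finally show ?thesis by (simp add: B_def)
  qed
  define a where "a z n = f (real N / (z + real (N + n)))" for z n
  let ?c = "\<lambda>z n. complex_of_real (V_coeff N (N + n) z)"
  \<comment> \<open>\<open>w\<close> bounds the speed at which an evaluation point moves with
    \<open>x\<close>; \<open>d\<close> is the second kind of term in the series for q.\<close>
  define w where "w n = real N / real (N + n) ^ 2" for n
  define d where "d n = real (Suc n) / real (N + Suc n) ^ 2 * (real N / (real (N + n) * real (N + Suc n)))" for n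
  have ab: "norm (a z n) \<le> B" if "z \<ge> 0" for z n
    unfolding a_def using U_op_point_mem[OF that] by (intro b)
  have Us: "(\<lambda>n. ?c z n * a z n) sums U_op N f z" if "z \<ge> 0" for z
    unfolding a_def using b that by (rule U_op_sums)
  have pos: "z + real (N + n) > 0" if "z \<ge> 0" for z n using N that by simp
  \<comment> \<open>\<open>Z\<close> again mixes the weights of \<open>y\<close> with the evaluation
    points of \<open>x\<close>, separating the two changes.\<close>
  obtain Z where Z: "(\<lambda>n. ?c y n * a x n) sums Z"
    using summable_norm_cancel[OF V_coeff_mult_summable[of y "a x" B]] ab xy
    by (auto simp: summable_def)

  have wb: "\<bar>w n\<bar> \<le> real N" for n
    using N by (auto simp: w_def divide_le_eq_1 intro!: mult_imp_div_pos_le)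
  have wdec: "decseq w"
    unfolding w_def decseq_Suc_iff using N
    by (intro allI divide_left_mono power_mono mult_pos_pos zero_less_power) auto
  have "summable (\<lambda>n. V_coeff N (N + n) z * w n)" if "z \<ge> 0" for z
    using summable_norm_cancel[OF V_coeff_mult_summable[of z w "real N"]] wb that by auto
  \<comment> \<open>\<open>P\<close>, the average of \<open>w\<close> under the weights at 0, is the
    first sum of q including the factor N; dominance puts the average \<open>Py\<close> below
    it.\<close>
  then obtain P Py where P: "(\<lambda>n. V_coeff N (N + n) 0 * w n) sums P"
    and Py: "(\<lambda>n. V_coeff N (N + n) y * w n) sums Py"
    using xy unfolding summable_def by (metis less_imp_le order_refl order_trans)
  have "Py \<le> P"
    using xy wb by (intro V_coeff_sums_decseq_le[OF _ _ wdec _ P Py]) auto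
  have Q: "d sums (q_const N - P)"
    using sums_diff[OF q_const_sums P[unfolded w_def]] by (simp add: d_def[abs_def])

  have shift: "norm (a y n - a x n) \<le> L * (y - x) * w n" for n
  proof -
    let ?i = "real (N + n)"
    have "norm (a y n - a x n) \<le> L * \<bar>real N / (y + ?i) - real N / (x + ?i)\<bar>"
      unfolding a_def using xy by (intro f U_op_point_mem) auto
    also have "\<bar>real N / (y + ?i) - real N / (x + ?i)\<bar> = (y - x) * (real N / ((x + ?i) * (y + ?i)))"
    proof -
      have "real N / (x + ?i) - real N / (y + ?i) = (y - x) * (real N / ((x + ?i) * (y + ?i)))"
        using pos[of x n] pos[of y n] xy by (simp add: divide_simps) (simp add: algebra_simps)
      moreover have "(y - x) * (real N / ((x + ?i) * (y + ?i))) \<ge> 0" using xy by simp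
      ultimately show ?thesis by linarith
    qed
    also have "real N / ((x + ?i) * (y + ?i)) \<le> w n"
      unfolding w_def power2_eq_square using xy N
      by (intro divide_left_mono mult_mono mult_pos_pos) auto
    finally show ?thesis using L xy by (simp add: mult_left_mono mult.assoc)
  qed
  have step: "norm (a x (Suc n) - a x n) \<le> L * (real N / (real (N + n) * real (N + Suc n)))" for n
  proof -
    let ?i = "real (N + n)"
    have S: "real (N + Suc n) = ?i + 1" by simp
    have "norm (a x (Suc n) - a x n) \<le> L * \<bar>real N / (x + real (N + Suc n)) - real N / (x + ?i)\<bar>"
      unfolding a_def using xy by (intro f U_op_point_mem) auto
    also have "\<bar>real N / (x + real (N + Suc n)) - real N / (x + ?i)\<bar> = real N / ((x + ?i) * (x + ?i + 1))"
    proof -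
      have "real N / (x + ?i) - real N / (x + real (N + Suc n)) = real N / ((x + ?i) * (x + ?i + 1))"
        unfolding S using pos[of x n] xy by (simp add: divide_simps) (simp add: algebra_simps)
      moreover have "real N / ((x + ?i) * (x + ?i + 1)) \<ge> 0" using xy by simp
      ultimately show ?thesis by linarith
    qed
    also have "\<dots> \<le> real N / (?i * real (N + Suc n))"
      unfolding S using xy N by (intro divide_left_mono mult_mono mult_pos_pos) auto
    finally show ?thesis using L by (simp add: mult_left_mono)
  qed

  have 1: "norm (U_op N f y - Z) \<le> L * (y - x) * P"
  proof -
    have s: "(\<lambda>n. ?c y n * (a y n - a x n)) sums (U_op N f y - Z)"
      using sums_diff[OF Us Z] xy by (simp add: right_diff_distrib)
    have s': "(\<lambda>n. L * (y - x) * (V_coeff N (N + n) y * w n)) sums (L * (y - x) * Py)"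
      by (rule sums_mult[OF Py])
    have le: "norm (?c y n * (a y n - a x n)) \<le> L * (y - x) * (V_coeff N (N + n) y * w n)" for n
      using mult_left_mono[OF shift[of n] V_coeff_nonneg[of y "N + n"]] V_coeff_nonneg[of y "N + n"] xy
      by (simp add: norm_mult mult_ac)
    have "norm (\<Sum>n. ?c y n * (a y n - a x n)) \<le> (\<Sum>n. L * (y - x) * (V_coeff N (N + n) y * w n))"
      by (rule norm_suminf_le[OF le sums_summable[OF s']])
    also have "\<dots> \<le> L * (y - x) * P"
      using \<open>Py \<le> P\<close> L xy s' by (simp add: sums_iff mult_left_mono)
    finally show ?thesis using s by (simp add: sums_iff)
  qed

  \<comment> \<open>Only the weights change here. Summation by parts pairs tail differences with
    increments of \<open>a x\<close>, bounded by \<open>DSuc\<close> and \<open>step\<close>; the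
    boundary term is at most \<open>D m * B\<close> and vanishes.\<close>
  have 2: "norm (Z - U_op N f x) \<le> L * (y - x) * (q_const N - P)"
  proof -
    define D where "D n = V_tail N n y - V_tail N n x" for n
    have D: "D n \<ge> 0" "D 0 = 0" for n
      using V_tail_mono[of x y n] xy by (auto simp: D_def V_tail_0)
    have V_diff: "V_coeff N (N + n) y - V_coeff N (N + n) x = D n - D (Suc n)" for n
      using xy by (simp add: D_def V_coeff_eq_V_tail_diff del: of_nat_add)
    have DSuc: "D (Suc n) \<le> (y - x) * (real (Suc n) / real (N + Suc n) ^ 2)" for n
    proof -
      have "D (Suc n) = (y - x) * (real (Suc n) / ((x + real (N + Suc n)) * (y + real (N + Suc n))))"
        unfolding D_def using xy by (subst V_tail_diff) auto
      also have "\<dots> \<le> (y - x) * (real (Suc n) / real (N + Suc n) ^ 2)"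
        unfolding power2_eq_square using xy
        by (intro mult_left_mono divide_left_mono mult_mono mult_pos_pos) auto
      finally show ?thesis .
    qed
    have lim: "(\<lambda>m. D m * B + L * (y - x) * (q_const N - P)) \<longlonglongrightarrow> L * (y - x) * (q_const N - P)"
      unfolding D_def by (auto intro!: tendsto_eq_intros V_tail_tendsto_0)
    have "(\<lambda>m. \<Sum>n<m. ?c y n * a x n - ?c x n * a x n) \<longlonglongrightarrow> Z - U_op N f x"
      using sums_diff[OF Z Us] xy by (simp add: sums_def)
    then have "(\<lambda>m. norm (\<Sum>n<m. ?c y n * a x n - ?c x n * a x n)) \<longlonglongrightarrow> norm (Z - U_op N f x)"
      by (rule tendsto_norm)
    moreover have "norm (\<Sum>n<m. ?c y n * a x n - ?c x n * a x n)
        \<le> D m * B + L * (y - x) * (q_const N - P)" for m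
    proof -
      have "(\<Sum>n<m. ?c y n * a x n - ?c x n * a x n) = (\<Sum>n<m. (D n - D (Suc n)) *\<^sub>R a x n)"
        by (simp add: V_diff[symmetric] scaleR_conv_of_real left_diff_distrib)
      also have "\<dots> = (\<Sum>n<m. D (Suc n) *\<^sub>R (a x (Suc n) - a x n)) - D m *\<^sub>R a x m"
        by (simp add: sum_by_parts D)
      also have "norm \<dots> \<le> (\<Sum>n<m. norm (D (Suc n) *\<^sub>R (a x (Suc n) - a x n))) + norm (D m *\<^sub>R a x m)"
        by (intro order_trans[OF norm_triangle_ineq4] add_right_mono norm_sum)
      also have "\<dots> \<le> (\<Sum>n<m. L * (y - x) * d n) + D m * B"
      proof (intro add_mono sum_mono)
        show "norm (D m *\<^sub>R a x m) \<le> D m * B"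
          using ab[of x m] D(1)[of m] xy by (simp add: mult_left_mono)
        show "norm (D (Suc n) *\<^sub>R (a x (Suc n) - a x n)) \<le> L * (y - x) * d n" for n
        proof -
          have "norm (D (Suc n) *\<^sub>R (a x (Suc n) - a x n)) = D (Suc n) * norm (a x (Suc n) - a x n)"
            using D(1) by simp
          also have "\<dots> \<le> ((y - x) * (real (Suc n) / real (N + Suc n) ^ 2))
              * (L * (real N / (real (N + n) * real (N + Suc n))))"
            using xy by (intro mult_mono DSuc step) auto
          also have "\<dots> = L * (y - x) * d n" by (simp add: d_def)
          finally show ?thesis .
        qed
      qed
      also have "(\<Sum>n<m. L * (y - x) * d n) \<le> L * (y - x) * (q_const N - P)"
      proof -
        have "(\<Sum>n<m. d n) \<le> q_const N - P"
          using sum_le_suminf[OF sums_summable[OF Q], of "{..<m}"] Q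
          by (auto simp: sums_iff d_def)
        then show ?thesis
          using L xy by (simp add: sum_distrib_left[symmetric] mult_left_mono)
      qed
      finally show ?thesis by simp
    qed
    ultimately show ?thesis
      using lim by (intro LIMSEQ_le) auto
  qed

  have "norm (U_op N f y - U_op N f x) \<le> norm (U_op N f y - Z) + norm (Z - U_op N f x)"
    using norm_triangle_ineq[of "U_op N f y - Z" "Z - U_op N f x"] by simp
  also have "\<dots> \<le> L * (y - x) * P + L * (y - x) * (q_const N - P)"
    using 1 2 by simp
  also have "\<dots> = q_const N * L * (y - x)"
    by (simp add: algebra_simps)
  finally show ?thesis .
qed

lemma lip_seminorm_on_U_op_le:
  assumes "f \<in> Lipschitz_space unit_ivl"
  shows "lip_seminorm_on unit_ivl (U_op N f) \<le> ereal (q_const N) * lip_seminorm_on unit_ivl f"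
proof -
  obtain C where C: "C-lipschitz_on unit_ivl f"
    using assms by (auto simp: Lipschitz_space_def)
  have up: "ereal (norm (f x - f y) / \<bar>x - y\<bar>) \<le> lip_seminorm_on unit_ivl f"
    if "x \<in> unit_ivl" "y \<in> unit_ivl" "x \<noteq> y" for x y
    unfolding lip_seminorm_on_def using that by (intro SUP_upper2[where i = "(x, y)"]) auto
  have "lip_seminorm_on unit_ivl f \<le> ereal C"
    unfolding lip_seminorm_on_def
  proof (rule SUP_least, clarify)
    fix x y :: real assume "x \<in> unit_ivl" "y \<in> unit_ivl" "x \<noteq> y"
    then show "ereal (norm (f x - f y) / \<bar>x - y\<bar>) \<le> ereal C"
      using lipschitz_onD[OF C, of x y] by (simp add: dist_norm divide_le_eq)
  qed
  moreover have ge: "0 \<le> lip_seminorm_on unit_ivl f"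
    using up[of 0 1] by (intro order_trans[OF _ up[of 0 1]]) auto
  \<comment> \<open>Being finite, the seminorm is a real number \<open>L\<close>, and
    \<open>L\<close> is itself a Lipschitz constant of \<open>f\<close>.\<close>
  ultimately obtain L where L: "lip_seminorm_on unit_ivl f = ereal L" "L \<ge> 0"
    by (cases "lip_seminorm_on unit_ivl f") auto
  have lip: "norm (f x - f y) \<le> L * \<bar>x - y\<bar>" if "x \<in> unit_ivl" "y \<in> unit_ivl" for x y
    using up[OF that] L by (cases "x = y") (auto simp: divide_le_eq)
  show ?thesis
    unfolding L lip_seminorm_on_def[of _ "U_op N f"]
  proof (rule SUP_least, clarify)
    fix x y :: real assume xy: "x \<in> unit_ivl" "y \<in> unit_ivl" "x \<noteq> y"
    have "norm (U_op N f x - U_op N f y) \<le> q_const N * L * \<bar>x - y\<bar>"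
      using U_op_lipschitz[OF lip L(2), of x y] U_op_lipschitz[OF lip L(2), of y x] xy
      by (cases "x < y") (auto simp: norm_minus_commute)
    then show "ereal (norm (U_op N f x - U_op N f y) / \<bar>x - y\<bar>) \<le> ereal (q_const N) * ereal L"
      using xy by (simp add: divide_le_eq)
  qed
qed

end

theorem proposition4p2:
  fixes N :: nat
  assumes "N \<ge> 1"
  shows "(\<forall>f \<in> Linfty_space unit_ivl.
      (nondecreasing_on unit_ivl f \<longrightarrow> nonincreasing_on unit_ivl (U_op N f)) \<and>
      (nonincreasing_on unit_ivl f \<longrightarrow> nondecreasing_on unit_ivl (U_op N f)) \<and>
      (nondecreasing_on unit_ivl f \<or> nonincreasing_on unit_ivl f \<longrightarrow>
        variation_on unit_ivl (U_op N f) \<le> ereal (1 / (real N + 1)) * variation_on unit_ivl f)) \<and>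
    (\<forall>f \<in> Lipschitz_space unit_ivl.
      lip_seminorm_on unit_ivl (U_op N f) \<le> ereal (q_const N) * lip_seminorm_on unit_ivl f)"
proof (intro conjI ballI)
  fix f assume "f \<in> Linfty_space unit_ivl"
  then obtain B where b: "\<And>t. t \<in> unit_ivl \<Longrightarrow> norm (f t) \<le> B"
    unfolding Linfty_space_def bounded_iff by blast
  \<comment> \<open>The same bound holds for \<open>- f\<close>, to which the non-decreasing case is
    applied when \<open>f\<close> is non-increasing.\<close>
  have b': "\<And>t. t \<in> unit_ivl \<Longrightarrow> norm (- f t) \<le> B"
    using b by simp
  show "nondecreasing_on unit_ivl f \<longrightarrow> nonincreasing_on unit_ivl (U_op N f)"
    using U_op_antimono[of N f B, OF assms b] by blast
  show "nonincreasing_on unit_ivl f \<longrightarrow> nondecreasing_on unit_ivl (U_op N f)"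
    using U_op_antimono[of N "\<lambda>t. - f t" B, OF assms b']
    by (simp add: U_op_uminus nondecreasing_on_uminus_iff nonincreasing_on_uminus_iff)
  show "nondecreasing_on unit_ivl f \<or> nonincreasing_on unit_ivl f \<longrightarrow>
      variation_on unit_ivl (U_op N f) \<le> ereal (1 / (real N + 1)) * variation_on unit_ivl f"
    using variation_on_U_op_le[of N f B, OF assms b] variation_on_U_op_le[of N "\<lambda>t. - f t" B, OF assms b']
    by (auto simp: U_op_uminus variation_on_uminus nondecreasing_on_uminus_iff)
qed (rule lip_seminorm_on_U_op_le[OF assms])

end
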